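(* Let $0<\delta<\tfrac12$. For $\alpha\in(0,1]$ put $\varphi_\alpha=\pi\frac{\sqrt{\alpha}}{1+\sqrt{\alpha}}$, and let $\alpha_\delta$ be the square of the root of the polynomial $$(5-6\delta+\delta^2)X^3+(1-\delta^2)X^2-(2\delta+1)X-1$$ that lies in $(0,1]$. Let $\mu$ be a probability measure on $\mathbb{S}^1$ with density $f\in P(\alpha,\varphi)$, where $$\alpha_\delta\leq\alpha\leq 1\qquad\text{and}\qquad \varphi\leq\delta\varphi_\alpha .$$ Then $\mu$ admits a well defined Fréchet mean, i.e. the Fréchet functional $F_\mu$ has a unique minimizer on $\mathbb{S}^1$.
   Context: $\mathbb{S}^1=\{(x_1,x_2)\in\mathbb{R}^2 : x_1^2+x_2^2=1\}$ is endowed with the arclength distance $d_{\mathbb{S}^1}(x,p)=2\arcsin(\|x-p\|/2)$. For a Borel probability measure $\mu$ on $\mathbb{S}^1$, $F_\mu(p)=\frac12\int_{\mathbb{S}^1} d_{\mathbb{S}^1}^2(x,p)\,d\mu(x)$ for $p\in\mathbb{S}^1$. For $p\in\mathbb{S}^1$, $e_p:[-\pi,\pi)\to\mathbb{S}^1$ is the bijection $e_p(\theta)=R_\theta p$, with $R_\theta$ the rotation of angle $\theta$. Densities on $\mathbb{S}^1$ are with respect to arclength measure, so that $f_p=f\circ e_p:[-\pi,\pi)\to\mathbb{R}^+$ is the Lebesgue density of the image of $\mu$ under $e_p^{-1}$. Property $P(p,\alpha,\varphi)$: for $p\in\mathbb{S}^1$, $\alpha\in(0,1]$, $\varphi\in(0,\pi)$,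 a probability density $f:\mathbb{S}^1\to\mathbb{R}^+$ satisfies $P(p,\alpha,\varphi)$ if $f_p(\theta)\leq\frac{1-\alpha}{2\pi}$ for all $\theta\in[-\pi,\pi)$ with $|\theta|\geq\varphi$. One writes $f\in P(\alpha,\varphi)$ if there is a $p\in\mathbb{S}^1$ such that $f$ satisfies $P(p,\alpha,\varphi)$. *)

theory Defs
  imports "HOL-Probability.Probability" "HOL-Computational_Algebra.Polynomial"
begin

abbreviation circle :: "(real^2) set" where
  "circle \<equiv> sphere 0 1"

definition circle_dist :: "real^2 \<Rightarrow> real^2 \<Rightarrow> real" where
  "circle_dist x p = 2 * arcsin (norm (x - p) / 2)"

definition rotate_by :: "real \<Rightarrow> real^2 \<Rightarrow> real^2" where
  "rotate_by \<theta> p = vector [cos \<theta> * p$1 - sin \<theta> * p$2, sin \<theta> * p$1 + cos \<theta> * p$2]"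

text \<open>The map \<open>e\<^sub>p\<close> is used on \<open>{-pi..<pi}\<close> only.\<close>

abbreviation circle_param :: "real^2 \<Rightarrow> real \<Rightarrow> real^2" where
  "circle_param p \<equiv> (\<lambda>\<theta>. rotate_by \<theta> p)"

text \<open>
  Arclength on the circle (total mass \<open>2 * pi\<close>), as the image of Lebesgue measure under the
  unit-speed parametrisation based at \<open>(1, 0)\<close>; by rotation invariance the base point is
  immaterial.
\<close>

definition arclength :: "(real^2) measure" where
  "arclength = distr (restrict_space lborel {-pi..<pi}) (restrict_space borel circle)
     (circle_param (vector [1, 0]))"

lemma circle_param_in_circle: "p \<in> circle \<Longrightarrow> circle_param p \<theta> \<in> circle"
proof -
  assume "p \<in> circle"
  then have p: "(p$1)\<^sup>2 + (p$2)\<^sup>2 = 1"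
    by (simp add: norm_vec_def L2_set_def sum_2)
  have "(cos \<theta> * p$1 - sin \<theta> * p$2)\<^sup>2 + (sin \<theta> * p$1 + cos \<theta> * p$2)\<^sup>2
      = ((sin \<theta>)\<^sup>2 + (cos \<theta>)\<^sup>2) * ((p$1)\<^sup>2 + (p$2)\<^sup>2)"
    by (simp only: power2_eq_square) algebra
  with p show ?thesis
    by (simp add: rotate_by_def norm_vec_def L2_set_def sum_2)
qed

lemma continuous_circle_param: "continuous_on UNIV (circle_param p)"
proof -
  have "continuous_on UNIV (\<lambda>\<theta>. circle_param p \<theta> $ i)" for i
  proof -
    have "continuous_on UNIV (\<lambda>\<theta>. cos \<theta> * p$1 - sin \<theta> * p$2)"
      "continuous_on UNIV (\<lambda>\<theta>. sin \<theta> * p$1 + cos \<theta> * p$2)"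
      by (intro continuous_intros)+
    then show ?thesis
      using exhaust_2[of i] by (auto simp: rotate_by_def)
  qed
  then have "continuous_on UNIV (\<lambda>\<theta>. \<chi> i. circle_param p \<theta> $ i)"
    by (intro continuous_on_vec_lambda)
  then show ?thesis by simp
qed

lemma measurable_circle_param:
  assumes "p \<in> circle"
  shows "circle_param p \<in>
    restrict_space lborel {-pi..<pi} \<rightarrow>\<^sub>M restrict_space borel circle"
proof (rule measurable_restrict_space2)
  show "circle_param p \<in> space (restrict_space lborel {-pi..<pi}) \<rightarrow> circle"
    using circle_param_in_circle[OF assms] by auto
  have "circle_param p \<in> lborel \<rightarrow>\<^sub>M borel"
    using borel_measurable_continuous_onI[OF continuous_circle_param] by simp
  then show "circle_param p \<in> restrict_space lborel {-pi..<pi} \<rightarrow>\<^sub>M borel"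
    by (rule measurable_restrict_space1)
qed

definition circle_prob_density :: "(real^2 \<Rightarrow> real) \<Rightarrow> bool" where
  "circle_prob_density f \<longleftrightarrow>
     f \<in> borel_measurable arclength \<and> (\<forall>x\<in>circle. 0 \<le> f x) \<and>
     prob_space (density arclength (\<lambda>x. ennreal (f x)))"

definition frechet_functional :: "(real^2) measure \<Rightarrow> real^2 \<Rightarrow> real" where
  "frechet_functional \<mu> p = 1 / 2 * (\<integral>x. (circle_dist x p)\<^sup>2 \<partial>\<mu>)"

definition frechet_minimizer :: "(real^2) measure \<Rightarrow> real^2 \<Rightarrow> bool" where
  "frechet_minimizer \<mu> p \<longleftrightarrow>
     p \<in> circle \<and> (\<forall>q\<in>circle. frechet_functional \<mu> p \<le> frechet_functional \<mu> q)"

definition property_P_at :: "real^2 \<Rightarrow> real \<Rightarrow> real \<Rightarrow> (real^2 \<Rightarrow> real) \<Rightarrow> bool" where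
  "property_P_at p \<alpha> \<phi> f \<longleftrightarrow>
     (\<forall>\<theta>\<in>{-pi..<pi}. \<phi> \<le> \<bar>\<theta>\<bar> \<longrightarrow> f (circle_param p \<theta>) \<le> (1 - \<alpha>) / (2 * pi))"

definition property_P :: "real \<Rightarrow> real \<Rightarrow> (real^2 \<Rightarrow> real) \<Rightarrow> bool" where
  "property_P \<alpha> \<phi> f \<longleftrightarrow> (\<exists>p\<in>circle. property_P_at p \<alpha> \<phi> f)"

definition phi_bound :: "real \<Rightarrow> real" where
  "phi_bound \<alpha> = pi * (sqrt \<alpha> / (1 + sqrt \<alpha>))"

definition alpha_poly :: "real \<Rightarrow> real poly" where
  "alpha_poly \<delta> = [: -1, - (2 * \<delta> + 1), 1 - \<delta>\<^sup>2, 5 - 6 * \<delta> + \<delta>\<^sup>2 :]"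

definition alpha_bound :: "real \<Rightarrow> real" where
  "alpha_bound \<delta> = (THE X. X \<in> {0<..1} \<and> poly (alpha_poly \<delta>) X = 0)\<^sup>2"

lemma alpha_poly_root_ex1:
  assumes "0 < \<delta>" "\<delta> < 1 / 2"
  shows "\<exists>!X. X \<in> {0<..1} \<and> poly (alpha_poly \<delta>) X = 0"
proof -
  let ?p = "alpha_poly \<delta>"
  have c3: "5 - 6 * \<delta> + \<delta>\<^sup>2 > 0" and c2: "1 - \<delta>\<^sup>2 > 0"
  proof -
    have "(1 - \<delta>) * (5 - \<delta>) > 0" "(1 - \<delta>) * (1 + \<delta>) > 0"
      using assms by simp_all
    then show "5 - 6 * \<delta> + \<delta>\<^sup>2 > 0" "1 - \<delta>\<^sup>2 > 0"
      by (simp_all add: algebra_simps power2_eq_square)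
  qed
  have "poly ?p 0 < 0" "poly ?p 1 > 0"
    using assms by (simp_all add: alpha_poly_def)
  then obtain x where x: "0 < x" "x < 1" "poly ?p x = 0"
    using poly_IVT_pos[of 0 1 ?p] by auto
  have uniq: False if ab: "0 < a" "a < b" "poly ?p a = 0" "poly ?p b = 0" for a b
  proof -
    let ?g = "\<lambda>X. (5 - 6 * \<delta> + \<delta>\<^sup>2) * X\<^sup>2 + (1 - \<delta>\<^sup>2) * X - 1 / X"
    have g: "?g X = 2 * \<delta> + 1" if "X > 0" "poly ?p X = 0" for X
      using that by (simp add: alpha_poly_def field_simps power2_eq_square)
    have "?g a < ?g b"
    proof -
      have "(5 - 6 * \<delta> + \<delta>\<^sup>2) * a\<^sup>2 < (5 - 6 * \<delta> + \<delta>\<^sup>2) * b\<^sup>2"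
        using c3 ab by (intro mult_strict_left_mono power_strict_mono) auto
      moreover have "(1 - \<delta>\<^sup>2) * a < (1 - \<delta>\<^sup>2) * b"
        using c2 ab by (intro mult_strict_left_mono) auto
      moreover have "1 / b < 1 / a"
        using ab by (simp add: frac_less2)
      ultimately show ?thesis by linarith
    qed
    with g[of a] g[of b] ab show False by simp
  qed
  show ?thesis
  proof (rule ex1I[of _ x])
    show "x \<in> {0<..1} \<and> poly ?p x = 0" using x by simp
    fix y assume "y \<in> {0<..1} \<and> poly ?p y = 0"
    then show "y = x" using uniq[of x y] uniq[of y x] x by force
  qed
qed

end

theory Submission
  imports Defs
begin

text \<open>
  Let the density be concentrated around \<open>p\<close>, identify the circle with the angles in
  \<open>{-pi..<pi}\<close> by \<open>circle_param p\<close>, and write \<open>F \<theta>\<close> for the Frechet functional at angle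
  \<open>\<theta>\<close>. A minimizer exists by compactness; the point is that there is only one.

  The squared distance between angles \<open>x\<close> and \<open>\<theta>\<close> is the parabola \<open>(x - \<theta>)\<^sup>2\<close> minus \<open>4 * pi\<close>
  times the convex kink \<open>max 0 (\<bar>x - \<theta>\<bar> - pi)\<close>, so convexity of \<open>F\<close> is destroyed only by the
  mass that sits beyond the antipode of \<open>\<theta>\<close>. If \<open>\<bar>\<theta>\<bar> \<le> pi - \<phi>\<close>, such mass lies at
  angles with \<open>\<bar>x\<bar> \<ge> \<phi>\<close>, where the density is at most \<open>1 - \<alpha>\<close> times the uniform one. For the uniform
  density rotation invariance makes \<open>F\<close> constant: the kinks cancel the parabola exactly. Hence the
  kinks of the given density cancel at most the share \<open>1 - \<alpha>\<close> of the parabola, the share \<open>\<alpha>\<close>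
  survives, and \<open>F\<close> is strictly convex on \<open>\<bar>\<theta>\<bar> \<le> pi - \<phi>\<close>
  (\<open>frechet_functional_midpoint\<close>). So at most one minimizer lies there.

  At the remaining angles \<open>F\<close> exceeds \<open>F 0\<close> (\<open>frechet_functional_near_antipode\<close>): the mass of
  the central arc is at distance at least \<open>pi - 2 * \<phi>\<close> from such an angle and at most \<open>\<phi>\<close> from
  \<open>0\<close>, while the other mass increases \<open>F 0\<close> by no more than its share of the uniform density.
  With \<open>u = \<phi> / pi\<close> this comparison succeeds if \<open>3 * \<alpha> * (1 - u) * (1 - 3 * u) > 1 - \<alpha>\<close>. Since
  \<open>3 * (1 - u) * (1 - 3 * u) + 1 = (2 - 3 * u)\<^sup>2\<close>, this says that
  \<open>sqrt \<alpha> * (2 - 3 * u) > 1\<close>. For \<open>\<phi> \<le> \<delta> * phi_bound \<alpha>\<close> and \<open>X = sqrt \<alpha>\<close> it follows from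
  \<open>(2 - 3 * \<delta>) * X\<^sup>2 + X > 1\<close>, which holds wherever \<open>alpha_poly \<delta>\<close> is nonnegative on
  \<open>{0<..1}\<close> (\<open>concentration_bound\<close>).

  Both integral estimates are instances of \<open>integral_concentrated_density_le\<close>.
\<close>

section \<open>Arclength distance in angular coordinates\<close>

lemma circle_iff: "p \<in> circle \<longleftrightarrow> (p$1)\<^sup>2 + (p$2)\<^sup>2 = 1"
  by (simp add: norm_vec_def L2_set_def sum_2)

lemma rotate_by_add: "rotate_by s (rotate_by t p) = rotate_by (s + t) p"
  by (simp add: rotate_by_def vec_eq_iff forall_2 cos_add sin_add algebra_simps)

lemma rotate_by_0 [simp]: "rotate_by 0 p = p"
  by (simp add: rotate_by_def vec_eq_iff forall_2)

lemma rotate_by_2pi: "rotate_by (s + 2 * pi) p = rotate_by s p"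
  by (simp add: rotate_by_def vec_eq_iff forall_2)

lemma circle_param_surj:
  assumes "p \<in> circle" "q \<in> circle"
  obtains t where "t \<in> {-pi..<pi}" "q = circle_param p t"
proof -
  define a where "a = p$1 * q$1 + p$2 * q$2"
  define b where "b = p$1 * q$2 - p$2 * q$1"
  have p: "(p$1)\<^sup>2 + (p$2)\<^sup>2 = 1" and q: "(q$1)\<^sup>2 + (q$2)\<^sup>2 = 1"
    using assms circle_iff by auto
  have "a\<^sup>2 + b\<^sup>2 = ((p$1)\<^sup>2 + (p$2)\<^sup>2) * ((q$1)\<^sup>2 + (q$2)\<^sup>2)"
    unfolding a_def b_def by algebra
  then have "a\<^sup>2 + b\<^sup>2 = 1" using p q by simp
  then obtain y where y: "- pi < y" "y \<le> pi" "a = cos y" "b = sin y"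
    using sincos_principal_value sincos_total_2pi by (metis)
  have "q$1 = a * p$1 - b * p$2" "q$2 = b * p$1 + a * p$2"
    using p unfolding a_def b_def by algebra+
  then have qy: "q = circle_param p y"
    by (simp add: rotate_by_def vec_eq_iff forall_2 y)
  show thesis
  proof (cases "y = pi")
    case True
    then have "q = circle_param p (- pi)"
      using qy rotate_by_2pi[of "- pi" p] by simp
    then show thesis using that[of "- pi"] by simp
  next
    case False
    then show thesis using that[of y] y qy by simp
  qed
qed

lemma circle_dist_circle_param:
  assumes "p \<in> circle"
  shows "circle_dist (circle_param p s) (circle_param p t) = 2 * arcsin \<bar>sin ((s - t) / 2)\<bar>"
proof -
  have p: "(p$1)\<^sup>2 + (p$2)\<^sup>2 = 1" using assms circle_iff by auto
  have "2 * ((s - t) / 2) = s - t" by simp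
  then have half: "cos (s - t) = 1 - 2 * (sin ((s - t) / 2))\<^sup>2"
    using cos_double_sin[of "(s - t) / 2"] by metis
  have "(norm (circle_param p s - circle_param p t))\<^sup>2
      = ((cos s - cos t)\<^sup>2 + (sin s - sin t)\<^sup>2) * ((p$1)\<^sup>2 + (p$2)\<^sup>2)"
    by (simp add: norm_vec_def L2_set_def sum_2 rotate_by_def) algebra
  also have "\<dots> = 2 - 2 * cos (s - t)"
    unfolding p cos_diff using sin_cos_squared_add[of s] sin_cos_squared_add[of t]
    by algebra
  also have "\<dots> = (2 * \<bar>sin ((s - t) / 2)\<bar>)\<^sup>2"
    using half by (simp add: power_mult_distrib)
  finally have "norm (circle_param p s - circle_param p t) = 2 * \<bar>sin ((s - t) / 2)\<bar>"
    by (rule power2_eq_imp_eq) auto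
  then show ?thesis by (simp add: circle_dist_def)
qed

text \<open>
  On \<open>\<bar>r\<bar> \<le> 2 * pi\<close> this is the square of the distance from \<open>r\<close> to the nearest multiple of
  \<open>2 * pi\<close>: for \<open>\<bar>r\<bar> \<ge> pi\<close> it equals \<open>(2 * pi - \<bar>r\<bar>)\<^sup>2\<close>. It is written as a parabola minus a
  convex function because the convexity argument treats the two parts separately.
\<close>

definition arc_sq :: "real \<Rightarrow> real" where
  "arc_sq r = r\<^sup>2 - 4 * pi * max 0 (\<bar>r\<bar> - pi)"

lemma circle_dist_sq_circle_param:
  assumes "p \<in> circle" "\<bar>s - t\<bar> \<le> 2 * pi"
  shows "(circle_dist (circle_param p s) (circle_param p t))\<^sup>2 = arc_sq (s - t)"
proof -
  define r where "r = \<bar>s - t\<bar>"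
  have r: "0 \<le> r" "r \<le> 2 * pi" using assms by (auto simp: r_def)
  have "\<bar>sin ((s - t) / 2)\<bar> = \<bar>sin (r / 2)\<bar>"
    by (auto simp: r_def abs_if minus_divide_left[symmetric] simp del: minus_diff_eq)
  also have "\<dots> = sin (r / 2)"
    using r by (simp add: sin_ge_zero)
  finally have d: "circle_dist (circle_param p s) (circle_param p t) = 2 * arcsin (sin (r / 2))"
    using circle_dist_circle_param[OF assms(1)] by simp
  show ?thesis
  proof (cases "r \<le> pi")
    case True
    then have "arcsin (sin (r / 2)) = r / 2"
      using r by (intro arcsin_sin) auto
    then have "circle_dist (circle_param p s) (circle_param p t) = r"
      unfolding d by simp
    with True show ?thesis unfolding arc_sq_def r_def[symmetric] by (simp add: r_def)
  next
    case False
    have "arcsin (sin (r / 2)) = arcsin (sin (pi - r / 2))" by (simp add: sin_diff)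
    also have "\<dots> = pi - r / 2"
      using r False by (intro arcsin_sin) auto
    finally have "circle_dist (circle_param p s) (circle_param p t) = 2 * pi - r"
      unfolding d by simp
    then have "(circle_dist (circle_param p s) (circle_param p t))\<^sup>2 = (2 * pi - r)\<^sup>2"
      by simp
    also have "\<dots> = r\<^sup>2 - 4 * pi * (r - pi)" by algebra
    finally show ?thesis using False unfolding arc_sq_def r_def[symmetric] by (simp add: r_def)
  qed
qed

lemma circle_dist_bounds:
  assumes "x \<in> circle" "q \<in> circle"
  shows "0 \<le> circle_dist x q" "circle_dist x q \<le> pi"
proof -
  have n: "norm (x - q) \<le> 2" using assms norm_triangle_ineq4[of x q] by simp
  show "0 \<le> circle_dist x q"
    unfolding circle_dist_def using n by (simp add: arcsin_nonneg)
  show "circle_dist x q \<le> pi"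
    unfolding circle_dist_def using n arcsin_ubound[of "norm (x - q) / 2"] norm_ge_zero[of "x-q"]
    by linarith
qed

lemma circle_dist_sq_bounds:
  assumes "x \<in> circle" "q \<in> circle"
  shows "0 \<le> (circle_dist x q)\<^sup>2" "(circle_dist x q)\<^sup>2 \<le> pi\<^sup>2"
  using circle_dist_bounds[OF assms] by (auto intro: power_mono)

lemma continuous_circle_dist:
  assumes "q \<in> circle"
  shows "continuous_on circle (\<lambda>x. circle_dist x q)" "continuous_on circle (\<lambda>x. circle_dist q x)"
proof -
  have n: "norm (x - q) \<le> 2" "norm (q - x) \<le> 2" if "x \<in> circle" for x
    using assms that norm_triangle_ineq4[of x q] norm_triangle_ineq4[of q x] by simp_all
  have m: "-1 \<le> norm z / 2" for z :: "real^2"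
    using norm_ge_zero[of z] by linarith
  show "continuous_on circle (\<lambda>x. circle_dist x q)"
    unfolding circle_dist_def using n m by (intro continuous_intros) auto
  show "continuous_on circle (\<lambda>x. circle_dist q x)"
    unfolding circle_dist_def using n m by (intro continuous_intros) auto
qed

section \<open>Rotation invariance of arclength\<close>

lemma space_arclength [simp]: "space arclength = circle"
  by (simp add: arclength_def space_restrict_space)

lemma sets_arclength: "sets arclength = sets (restrict_space borel circle)"
  by (simp add: arclength_def)

text \<open>
  The translated period \<open>{t - pi..<t + pi}\<close> is cut at \<open>pi\<close>, and the piece beyond \<open>pi\<close> is moved
  back by one period.
\<close>

lemma nn_integral_periodic_shift:
  fixes h :: "real \<Rightarrow> ennreal"
  assumes [measurable]: "h \<in> borel_measurable borel"
    and per: "\<And>x. h (x + 2 * pi) = h x" and t: "0 \<le> t" "t \<le> 2 * pi"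
  shows "(\<integral>\<^sup>+x\<in>{-pi..<pi}. h (x + t) \<partial>lborel) = (\<integral>\<^sup>+x\<in>{-pi..<pi}. h x \<partial>lborel)"
proof -
  have shift: "(\<integral>\<^sup>+x. k x \<partial>lborel) = (\<integral>\<^sup>+x. k (x + c) \<partial>lborel)"
    if "k \<in> borel_measurable borel" for k :: "real \<Rightarrow> ennreal" and c :: real
    using nn_integral_real_affine[of k 1 c] that by (simp add: add.commute)
  have "(\<integral>\<^sup>+x\<in>{-pi..<pi}. h (x + t) \<partial>lborel)
      = (\<integral>\<^sup>+x. h x * indicator {t - pi..<t + pi} x \<partial>lborel)"
    by (subst shift[of "\<lambda>x. h x * indicator {t - pi..<t + pi} x" t])
       (auto intro!: nn_integral_cong split: split_indicator)
  also have "\<dots> = (\<integral>\<^sup>+x. h x * indicator {t - pi..<pi} x + h x * indicator {pi..<t + pi} x \<partial>lborel)"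
    using t by (intro nn_integral_cong) (auto split: split_indicator)
  also have "\<dots> = (\<integral>\<^sup>+x. h x * indicator {t - pi..<pi} x \<partial>lborel)
      + (\<integral>\<^sup>+x. h x * indicator {pi..<t + pi} x \<partial>lborel)"
    by (intro nn_integral_add) auto
  also have "(\<integral>\<^sup>+x. h x * indicator {pi..<t + pi} x \<partial>lborel)
      = (\<integral>\<^sup>+x. h x * indicator {-pi..<t - pi} x \<partial>lborel)"
    by (subst shift[of "\<lambda>x. h x * indicator {pi..<t + pi} x" "2 * pi"])
       (auto intro!: nn_integral_cong simp: per split: split_indicator)
  also have "(\<integral>\<^sup>+x. h x * indicator {t - pi..<pi} x \<partial>lborel)
      + (\<integral>\<^sup>+x. h x * indicator {-pi..<t - pi} x \<partial>lborel)
      = (\<integral>\<^sup>+x. h x * indicator {t - pi..<pi} x + h x * indicator {-pi..<t - pi} x \<partial>lborel)"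
    by (intro nn_integral_add[symmetric]) auto
  also have "\<dots> = (\<integral>\<^sup>+x\<in>{-pi..<pi}. h x \<partial>lborel)"
    using t by (intro nn_integral_cong) (auto split: split_indicator)
  finally show ?thesis .
qed

text \<open>
  Rotation invariance: a change of base point is a translation of the angle, and the circle
  parametrisation is \<open>2 * pi\<close>-periodic.
\<close>

lemma arclength_eq_distr:
  assumes "p \<in> circle"
  shows "arclength = distr (restrict_space lborel {-pi..<pi}) (restrict_space borel circle)
    (circle_param p)"
proof -
  define base :: "real^2" where "base = vector [1, 0]"
  have base: "base \<in> circle" unfolding circle_iff by (simp add: base_def)
  obtain t where t: "0 \<le> t" "t \<le> 2 * pi" "p = circle_param base t"
  proof -
    obtain s where s: "s \<in> {-pi..<pi}" "p = circle_param base s"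
      using circle_param_surj[OF base assms] .
    show thesis
      using that[of s] that[of "s + 2 * pi"] s pi_gt_zero rotate_by_2pi[of s base]
      by (cases "0 \<le> s") auto
  qed
  let ?M = "restrict_space lborel {-pi..<pi}"
  let ?N = "restrict_space borel circle :: (real^2) measure"
  have em: "emeasure (distr ?M ?N (circle_param q)) A
      = (\<integral>\<^sup>+x\<in>{-pi..<pi}. indicator A (circle_param q x) \<partial>lborel)"
    if "A \<in> sets ?N" "q \<in> circle" for q A
  proof -
    have [measurable]: "circle_param q \<in> ?M \<rightarrow>\<^sub>M ?N"
      using measurable_circle_param that by blast
    have "emeasure (distr ?M ?N (circle_param q)) A
        = (\<integral>\<^sup>+x. indicator A x \<partial>distr ?M ?N (circle_param q))"
      using that by simp
    also have "\<dots> = (\<integral>\<^sup>+x. indicator A (circle_param q x) \<partial>?M)"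
      using that by (intro nn_integral_distr) auto
    also have "\<dots> = (\<integral>\<^sup>+x\<in>{-pi..<pi}. indicator A (circle_param q x) \<partial>lborel)"
      by (subst nn_integral_restrict_space) auto
    finally show ?thesis .
  qed
  have "distr ?M ?N (circle_param base) = distr ?M ?N (circle_param p)"
  proof (rule measure_eqI)
    fix A assume "A \<in> sets (distr ?M ?N (circle_param base))"
    then have A: "A \<in> sets ?N" by simp
    then have [measurable]: "A \<in> sets borel"
      by (auto simp: sets_restrict_space)
    have [measurable]: "circle_param base \<in> borel_measurable borel"
      by (rule borel_measurable_continuous_onI[OF continuous_circle_param])
    have "(\<integral>\<^sup>+x\<in>{-pi..<pi}. indicator A (circle_param p x) \<partial>lborel)
        = (\<integral>\<^sup>+x\<in>{-pi..<pi}. indicator A (circle_param base (x + t)) \<partial>lborel)"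
      by (simp add: t(3) rotate_by_add)
    also have "\<dots> = (\<integral>\<^sup>+x\<in>{-pi..<pi}. indicator A (circle_param base x) \<partial>lborel)"
      using t by (intro nn_integral_periodic_shift) (auto simp: rotate_by_2pi)
    finally show "emeasure (distr ?M ?N (circle_param base)) A
        = emeasure (distr ?M ?N (circle_param p)) A"
      using em A base assms by simp
  qed simp
  then show ?thesis unfolding arclength_def base_def .
qed

lemma integral_arclength:
  fixes h :: "real^2 \<Rightarrow> real"
  assumes "h \<in> borel_measurable arclength" "p \<in> circle"
  shows "(\<integral>x. h x \<partial>arclength) = (\<integral>\<theta>\<in>{-pi..<pi}. h (circle_param p \<theta>) \<partial>lborel)"
proof -
  have "(\<integral>x. h x \<partial>arclength) = (\<integral>\<theta>. h (circle_param p \<theta>) \<partial>restrict_space lborel {-pi..<pi})"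
    using assms measurable_circle_param[of p]
    by (subst arclength_eq_distr[of p])
       (auto intro!: integral_distr simp: measurable_cong_sets[OF sets_arclength refl])
  also have "\<dots> = (\<integral>\<theta>\<in>{-pi..<pi}. h (circle_param p \<theta>) \<partial>lborel)"
    by (simp add: integral_restrict_space set_lebesgue_integral_def)
  finally show ?thesis .
qed

lemma emeasure_arclength: "emeasure arclength circle = ennreal (2 * pi)"
proof -
  have base: "vector [1, 0] \<in> circle" unfolding circle_iff by simp
  have "emeasure arclength circle = emeasure (restrict_space lborel {-pi..<pi}) {-pi..<pi}"
    unfolding arclength_def using measurable_circle_param[OF base] circle_param_in_circle[OF base]
    by (subst emeasure_distr)
       (auto simp: sets_restrict_space space_restrict_space intro!: arg_cong2[where f=emeasure])
  then show ?thesis by (simp add: emeasure_restrict_space)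
qed

lemma finite_measure_arclength: "finite_measure arclength"
  by (rule finite_measureI) (simp add: emeasure_arclength)

lemma measure_arclength: "measure arclength circle = 2 * pi"
  by (simp add: measure_def emeasure_arclength)

lemma borel_measurable_circle_dist [measurable]:
  assumes "q \<in> circle"
  shows "(\<lambda>x. circle_dist x q) \<in> borel_measurable arclength"
  unfolding measurable_cong_sets[OF sets_arclength refl]
  by (rule borel_measurable_continuous_on_restrict[OF continuous_circle_dist(1)[OF assms]])

lemma integrable_arclength_circle_dist_sq:
  assumes "q \<in> circle"
  shows "integrable arclength (\<lambda>x. (circle_dist x q)\<^sup>2)"
proof -
  interpret finite_measure arclength by (rule finite_measure_arclength)
  show ?thesis
    using assms circle_dist_sq_bounds[OF _ assms]
    by (intro integrable_const_bound[where B = "pi\<^sup>2"]) (auto intro!: AE_I2)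
qed

text \<open>
  The value matters less than its independence of \<open>q\<close>: the Frechet functional of the uniform
  distribution is constant.
\<close>

lemma integral_arclength_circle_dist_sq:
  assumes "q \<in> circle"
  shows "(\<integral>x. (circle_dist x q)\<^sup>2 \<partial>arclength) = 2 * pi ^ 3 / 3"
proof -
  have "(\<integral>x. (circle_dist x q)\<^sup>2 \<partial>arclength)
      = (\<integral>\<theta>\<in>{-pi..<pi}. (circle_dist (circle_param q \<theta>) q)\<^sup>2 \<partial>lborel)"
    using assms by (intro integral_arclength) auto
  also have "\<dots> = (\<integral>\<theta>\<in>{-pi..pi}. \<theta>\<^sup>2 \<partial>lborel)"
  proof (unfold set_lebesgue_integral_def, rule integral_cong_AE)
    have "circle_dist (circle_param q \<theta>) q ^ 2 = \<theta>\<^sup>2" if "\<theta> \<in> {-pi..<pi}" for \<theta>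
      using circle_dist_sq_circle_param[OF assms, of \<theta> 0] that
      by (auto simp: arc_sq_def max_def)
    then show "AE \<theta> in lborel. indicat_real {-pi..<pi} \<theta> *\<^sub>R (circle_dist (circle_param q \<theta>) q)\<^sup>2
        = indicat_real {-pi..pi} \<theta> *\<^sub>R \<theta>\<^sup>2"
      by (intro AE_I'[of "{pi}"]) (auto split: split_indicator)
    have "(\<lambda>\<theta>. indicat_real {-pi..<pi} \<theta> *\<^sub>R (circle_dist (circle_param q \<theta>) q)\<^sup>2)
        = (\<lambda>\<theta>. indicat_real {-pi..<pi} \<theta> *\<^sub>R \<theta>\<^sup>2)"
      using \<open>\<And>\<theta>. \<theta> \<in> {-pi..<pi} \<Longrightarrow> _\<close> by (auto split: split_indicator)
    then show "(\<lambda>\<theta>. indicat_real {-pi..<pi} \<theta> *\<^sub>R (circle_dist (circle_param q \<theta>) q)\<^sup>2)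
        \<in> borel_measurable lborel" by simp
  qed simp
  also have "\<dots> = 2 * pi ^ 3 / 3"
    using integral_power[of "- pi" pi 2] by (simp add: set_lebesgue_integral_def mult.commute power3_eq_cube)
  finally show ?thesis .
qed

section \<open>The Frechet functional of a density\<close>

lemma integrable_density_mult:
  assumes "circle_prob_density f" "h \<in> borel_measurable arclength"
    and "\<And>x. x \<in> circle \<Longrightarrow> \<bar>h x\<bar> \<le> C"
  shows "integrable arclength (\<lambda>x. f x * h x)"
proof -
  have f [measurable]: "f \<in> borel_measurable arclength" and nn: "\<And>x. x \<in> circle \<Longrightarrow> 0 \<le> f x"
    using assms(1) by (auto simp: circle_prob_density_def)
  interpret prob_space "density arclength (\<lambda>x. ennreal (f x))"
    using assms(1) by (auto simp: circle_prob_density_def)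
  have "integrable (density arclength (\<lambda>x. ennreal (f x))) h"
    using assms by (intro integrable_const_bound[where B = C]) (auto intro!: AE_I2)
  then show ?thesis
    using assms(2) nn by (subst (asm) integrable_density) (auto intro!: AE_I2)
qed

lemma integral_density_eq_1:
  assumes "circle_prob_density f"
  shows "(\<integral>x. f x \<partial>arclength) = 1"
proof -
  have f [measurable]: "f \<in> borel_measurable arclength" and nn: "\<And>x. x \<in> circle \<Longrightarrow> 0 \<le> f x"
    using assms(1) by (auto simp: circle_prob_density_def)
  interpret prob_space "density arclength (\<lambda>x. ennreal (f x))"
    using assms(1) by (auto simp: circle_prob_density_def)
  have "(\<integral>x. 1 \<partial>density arclength (\<lambda>x. ennreal (f x))) = (1::real)"
    using prob_space by simp
  then show ?thesis
    using nn by (subst (asm) integral_density) (auto intro!: AE_I2)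
qed

lemma frechet_functional_density:
  assumes "circle_prob_density f" "q \<in> circle"
  shows "frechet_functional (density arclength (\<lambda>x. ennreal (f x))) q
    = 1 / 2 * (\<integral>x. f x * (circle_dist x q)\<^sup>2 \<partial>arclength)"
  using assms unfolding frechet_functional_def
  by (subst integral_density) (auto intro!: AE_I2 simp: circle_prob_density_def)

lemma integrable_density_circle_dist_sq:
  assumes "circle_prob_density f" "q \<in> circle"
  shows "integrable arclength (\<lambda>x. f x * (circle_dist x q)\<^sup>2)"
  using assms circle_dist_sq_bounds[OF _ assms(2)]
  by (intro integrable_density_mult[where C = "pi\<^sup>2"]) auto

lemma integrable_density:
  assumes "circle_prob_density f"
  shows "integrable arclength f"
  using integrable_density_mult[OF assms, of "\<lambda>_. 1" 1] by simp

lemma continuous_frechet_functional: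
  assumes "circle_prob_density f"
  shows "continuous_on circle (frechet_functional (density arclength (\<lambda>x. ennreal (f x))))"
  unfolding continuous_on_sequentially
proof (intro allI ballI impI)
  let ?F = "frechet_functional (density arclength (\<lambda>x. ennreal (f x)))"
  fix u q assume q: "q \<in> circle" and u: "(\<forall>n. u n \<in> circle) \<and> u \<longlonglongrightarrow> q"
  have [measurable]: "f \<in> borel_measurable arclength" and nn: "\<And>x. x \<in> circle \<Longrightarrow> 0 \<le> f x"
    using assms by (auto simp: circle_prob_density_def)
  have "(\<lambda>n. \<integral>x. f x * (circle_dist x (u n))\<^sup>2 \<partial>arclength)
      \<longlonglongrightarrow> (\<integral>x. f x * (circle_dist x q)\<^sup>2 \<partial>arclength)"
  proof (rule integral_dominated_convergence[where w = "\<lambda>x. f x * pi\<^sup>2"])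
    show "integrable arclength (\<lambda>x. f x * pi\<^sup>2)"
      using integrable_density[OF assms] by simp
    show "AE x in arclength. (\<lambda>n. f x * (circle_dist x (u n))\<^sup>2) \<longlonglongrightarrow> f x * (circle_dist x q)\<^sup>2"
    proof (rule AE_I2)
      fix x assume "x \<in> space arclength"
      then have "continuous_on circle (circle_dist x)"
        using continuous_circle_dist(2)[of x] by simp
      then have "(\<lambda>n. circle_dist x (u n)) \<longlonglongrightarrow> circle_dist x q"
        using q u by (auto simp: continuous_on_sequentially comp_def)
      then show "(\<lambda>n. f x * (circle_dist x (u n))\<^sup>2) \<longlonglongrightarrow> f x * (circle_dist x q)\<^sup>2"
        by (intro tendsto_intros)
    qed
    show "AE x in arclength. norm (f x * (circle_dist x (u n))\<^sup>2) \<le> f x * pi\<^sup>2" for n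
      using u nn circle_dist_sq_bounds
      by (intro AE_I2) (auto simp: abs_mult intro!: mult_mono)
  qed (use q u in auto)
  then show "(?F \<circ> u) \<longlonglongrightarrow> ?F q"
    using q u by (simp add: comp_def frechet_functional_density[OF assms] tendsto_divide)
qed

text \<open>
  Outside the central arc the density may be replaced by its bound. This gives an upper estimate
  for integrands \<open>h\<close> that are nonpositive on the central arc, because there the mass,
  however large, can only decrease the integral. The majorant \<open>w\<close> is nonnegative on the whole
  circle, so that its integral may be taken over the central arc too.
\<close>

lemma integral_concentrated_density_le:
  assumes f: "circle_prob_density f" and p: "p \<in> circle" and P: "property_P_at p \<alpha> \<phi> f"
    and h: "integrable arclength (\<lambda>x. f x * h x)" and w: "integrable arclength w"
    and near: "\<And>\<theta>. \<theta> \<in> {-pi..<pi} \<Longrightarrow> \<bar>\<theta>\<bar> < \<phi> \<Longrightarrow> h (circle_param p \<theta>) \<le> 0"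
    and hw: "\<And>x. x \<in> circle \<Longrightarrow> h x \<le> w x" "\<And>x. x \<in> circle \<Longrightarrow> 0 \<le> w x"
    and "\<alpha> \<le> 1"
  shows "(\<integral>x. f x * h x \<partial>arclength) \<le> (1 - \<alpha>) / (2 * pi) * (\<integral>x. w x \<partial>arclength)"
proof -
  have "f x * h x \<le> (1 - \<alpha>) / (2 * pi) * w x" if x: "x \<in> circle" for x
  proof -
    obtain \<theta> where \<theta>: "\<theta> \<in> {-pi..<pi}" "x = circle_param p \<theta>"
      using circle_param_surj[OF p x] .
    have f0: "0 \<le> f x" using f x by (auto simp: circle_prob_density_def)
    have c0: "0 \<le> (1 - \<alpha>) / (2 * pi)" using \<open>\<alpha> \<le> 1\<close> by simp
    show ?thesis
    proof (cases "\<bar>\<theta>\<bar> < \<phi>")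
      case True
      then have "f x * h x \<le> 0" using near \<theta> f0 by (simp add: mult_nonneg_nonpos)
      also have "0 \<le> (1 - \<alpha>) / (2 * pi) * w x" using c0 hw(2)[OF x] by (rule mult_nonneg_nonneg)
      finally show ?thesis .
    next
      case False
      then have "f x \<le> (1 - \<alpha>) / (2 * pi)" using P \<theta> by (auto simp: property_P_at_def)
      then have "f x * w x \<le> (1 - \<alpha>) / (2 * pi) * w x" using hw(2)[OF x] by (rule mult_right_mono)
      moreover have "f x * h x \<le> f x * w x" using hw(1)[OF x] f0 by (rule mult_left_mono)
      ultimately show ?thesis by linarith
    qed
  qed
  then have "(\<integral>x. f x * h x \<partial>arclength) \<le> (\<integral>x. (1 - \<alpha>) / (2 * pi) * w x \<partial>arclength)"
    using h w by (intro integral_mono) auto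
  then show ?thesis by simp
qed

section \<open>Strict convexity away from the antipode\<close>

text \<open>
  The estimate behind the strict inequality is
  \<open>F s + F t - 2 * F ((s + t) / 2) \<ge> \<alpha> * (s - t)\<^sup>2 / 4\<close>. The function \<open>w\<close> of the proof is the
  deficit of the second difference of the squared distance with respect to that of a parabola. It
  is carried by the kinks: it is nonnegative, vanishes on the central arc, and its arclength
  integral is \<open>pi * (s - t)\<^sup>2\<close>, because the second difference itself integrates to \<open>0\<close> by
  rotation invariance.
\<close>

lemma frechet_functional_midpoint:
  assumes f: "circle_prob_density f" and p: "p \<in> circle" and P: "property_P_at p \<alpha> \<phi> f"
    and \<alpha>: "0 < \<alpha>" "\<alpha> \<le> 1" and "0 < \<phi>"
    and s: "\<bar>s\<bar> \<le> pi - \<phi>" and t: "\<bar>t\<bar> \<le> pi - \<phi>" and "s \<noteq> t"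
  defines "F \<equiv> \<lambda>\<theta>. frechet_functional (density arclength (\<lambda>x. ennreal (f x))) (circle_param p \<theta>)"
  shows "2 * F ((s + t) / 2) < F s + F t"
proof -
  define m where "m = (s + t) / 2"
  have m: "\<bar>m\<bar> \<le> pi - \<phi>" using s t by (simp add: m_def)
  define d where "d \<theta> x = (circle_dist x (circle_param p \<theta>))\<^sup>2" for \<theta> x
  define w where "w x = (s - t)\<^sup>2 / 2 - (d s x + d t x - 2 * d m x)" for x
  have q: "circle_param p \<theta> \<in> circle" for \<theta> using circle_param_in_circle[OF p] .
  have int_d: "integrable arclength (d \<theta>)" for \<theta>
    unfolding d_def using integrable_arclength_circle_dist_sq[OF q] .
  have int_fd: "integrable arclength (\<lambda>x. f x * d \<theta> x)" for \<theta>
    unfolding d_def using integrable_density_circle_dist_sq[OF f q] .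
  have int_f: "integrable arclength f" using integrable_density[OF f] .
  interpret finite_measure arclength by (rule finite_measure_arclength)
  define k where "k \<theta> x = max 0 (\<bar>x - \<theta>\<bar> - pi)" for \<theta> x :: real
  have wk: "w (circle_param p \<theta>) = 4 * pi * (k s \<theta> + k t \<theta> - 2 * k m \<theta>)" if "\<theta> \<in> {-pi..<pi}" for \<theta>
  proof -
    have dk: "d r (circle_param p \<theta>) = (\<theta> - r)\<^sup>2 - 4 * pi * k r \<theta>" if "\<bar>r\<bar> \<le> pi - \<phi>" for r
      using circle_dist_sq_circle_param[OF p, of \<theta> r] that \<open>\<theta> \<in> _\<close> \<open>0 < \<phi>\<close>
      by (auto simp: d_def k_def arc_sq_def)
    have "(\<theta> - s)\<^sup>2 + (\<theta> - t)\<^sup>2 - 2 * (\<theta> - m)\<^sup>2 = (s - t)\<^sup>2 / 2"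
      unfolding m_def by (simp add: field_simps power2_eq_square)
    then show ?thesis
      unfolding w_def dk[OF s] dk[OF t] dk[OF m] by (simp add: algebra_simps)
  qed
  have fw: "f x * w x = (s - t)\<^sup>2 / 2 * f x - (f x * d s x + f x * d t x - 2 * (f x * d m x))" for x
    unfolding w_def by (simp add: algebra_simps)
  have "(\<integral>x. f x * w x \<partial>arclength) \<le> (1 - \<alpha>) / (2 * pi) * (\<integral>x. w x \<partial>arclength)"
  proof (rule integral_concentrated_density_le[OF f p P])
    show "integrable arclength w" unfolding w_def using int_d by simp
    show "integrable arclength (\<lambda>x. f x * w x)"
      unfolding fw using int_fd int_f by simp
    show "w (circle_param p \<theta>) \<le> 0" if "\<theta> \<in> {-pi..<pi}" "\<bar>\<theta>\<bar> < \<phi>" for \<theta>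
    proof -
      have "k r \<theta> = 0" if "\<bar>r\<bar> \<le> pi - \<phi>" for r
        using that \<open>\<bar>\<theta>\<bar> < \<phi>\<close> by (simp add: k_def)
      then show ?thesis using wk[OF that(1)] s t m by simp
    qed
    show "0 \<le> w x" if x: "x \<in> circle" for x
    proof -
      obtain \<theta> where \<theta>: "\<theta> \<in> {-pi..<pi}" "x = circle_param p \<theta>"
        using circle_param_surj[OF p x] .
      have "2 * k m \<theta> \<le> k s \<theta> + k t \<theta>" unfolding k_def m_def by (simp add: max_def abs_if field_simps)
      then show ?thesis using wk[OF \<theta>(1)] \<theta>(2) by simp
    qed
  qed (use \<alpha> in auto)
  also have "(\<integral>x. w x \<partial>arclength) = pi * (s - t)\<^sup>2"
    unfolding w_def using int_d
    by (simp add: integral_arclength_circle_dist_sq[OF q, folded d_def] measure_arclength)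
  finally have "(\<integral>x. f x * w x \<partial>arclength) \<le> (1 - \<alpha>) / 2 * (s - t)\<^sup>2" by simp
  moreover have "(\<integral>x. f x * w x \<partial>arclength)
      = (s - t)\<^sup>2 / 2 - (2 * F s + 2 * F t - 4 * F m)"
  proof -
    show ?thesis
      using int_fd int_f unfolding fw F_def frechet_functional_density[OF f q] d_def[symmetric]
      by (simp add: integral_density_eq_1[OF f])
  qed
  moreover have "0 < \<alpha> * (s - t)\<^sup>2" using \<alpha> \<open>s \<noteq> t\<close> by simp
  ultimately show ?thesis unfolding m_def by (simp add: field_simps)
qed

section \<open>No minimizer near the antipode\<close>

text \<open>
  The constant \<open>(pi - \<phi>) * (pi - 3 * \<phi>)\<close> is \<open>(pi - 2 * \<phi>)\<^sup>2 - \<phi>\<^sup>2\<close>, the least amount by which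
  the squared distance to a point of the central arc grows on passing from \<open>p\<close> to an angle near
  the antipode. Mass outside the central arc is charged with losing this gain and, in addition,
  its whole contribution to the functional at \<open>p\<close>.
\<close>

lemma frechet_functional_near_antipode:
  assumes f: "circle_prob_density f" and p: "p \<in> circle" and P: "property_P_at p \<alpha> \<phi> f"
    and \<alpha>: "\<alpha> \<le> 1" and \<phi>: "0 < \<phi>" "3 * \<phi> \<le> pi"
    and bound: "(1 - \<alpha>) * pi\<^sup>2 < 3 * \<alpha> * ((pi - \<phi>) * (pi - 3 * \<phi>))"
    and t: "pi - \<phi> \<le> \<bar>t\<bar>" "\<bar>t\<bar> \<le> pi"
  defines "F \<equiv> frechet_functional (density arclength (\<lambda>x. ennreal (f x)))"
  shows "F p < F (circle_param p t)"
proof -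
  define B where "B = (pi - \<phi>) * (pi - 3 * \<phi>)"
  have B: "B = (pi - 2 * \<phi>)\<^sup>2 - \<phi>\<^sup>2" unfolding B_def by algebra
  have B0: "0 \<le> B" unfolding B_def using \<phi> by simp
  define q where "q = circle_param p t"
  have q: "q \<in> circle" unfolding q_def using circle_param_in_circle[OF p] .
  define h where "h x = B - (circle_dist x q)\<^sup>2 + (circle_dist x p)\<^sup>2" for x
  note ints = integrable_arclength_circle_dist_sq[OF p]
    integrable_density_circle_dist_sq[OF f p] integrable_density_circle_dist_sq[OF f q]
    integrable_density[OF f]
  interpret finite_measure arclength by (rule finite_measure_arclength)
  have "(\<integral>x. f x * h x \<partial>arclength)
      \<le> (1 - \<alpha>) / (2 * pi) * (\<integral>x. B + (circle_dist x p)\<^sup>2 \<partial>arclength)"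
  proof (rule integral_concentrated_density_le[OF f p P])
    show "integrable arclength (\<lambda>x. B + (circle_dist x p)\<^sup>2)" using ints by simp
    show "integrable arclength (\<lambda>x. f x * h x)"
      unfolding h_def using ints by (simp add: algebra_simps)
    show "h (circle_param p \<theta>) \<le> 0" if \<theta>: "\<theta> \<in> {-pi..<pi}" "\<bar>\<theta>\<bar> < \<phi>" for \<theta>
    proof -
      have "(circle_dist (circle_param p \<theta>) p)\<^sup>2 = \<theta>\<^sup>2"
        using circle_dist_sq_circle_param[OF p, of \<theta> 0] \<theta> by (auto simp: arc_sq_def max_def)
      also have "\<dots> \<le> \<phi>\<^sup>2" using \<theta> abs_le_square_iff[of \<theta> \<phi>] by simp
      finally have 1: "(circle_dist (circle_param p \<theta>) p)\<^sup>2 \<le> \<phi>\<^sup>2" .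
      define r where "r = \<bar>\<theta> - t\<bar>"
      have r: "pi - 2 * \<phi> \<le> r" "r \<le> pi + \<phi>" using \<theta> t by (auto simp: r_def)
      have "(pi - 2 * \<phi>)\<^sup>2 \<le> arc_sq (\<theta> - t)"
      proof (cases "r \<le> pi")
        case True
        have "(pi - 2 * \<phi>)\<^sup>2 \<le> r\<^sup>2" using r \<phi> by (intro power_mono) auto
        then show ?thesis using True unfolding arc_sq_def r_def[symmetric] by (simp add: r_def)
      next
        case False
        have "(pi - 2 * \<phi>)\<^sup>2 \<le> (2 * pi - r)\<^sup>2" using r \<phi> by (intro power_mono) auto
        also have "\<dots> = r\<^sup>2 - 4 * pi * (r - pi)" by algebra
        finally show ?thesis using False unfolding arc_sq_def r_def[symmetric] by (simp add: r_def)
      qed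
      also have "\<dots> = (circle_dist (circle_param p \<theta>) q)\<^sup>2"
        unfolding q_def using circle_dist_sq_circle_param[OF p, of \<theta> t] r \<phi> by (simp add: r_def)
      finally show ?thesis using 1 unfolding h_def B by simp
    qed
  qed (use \<alpha> B0 in \<open>auto simp: h_def\<close>)
  also have "(\<integral>x. B + (circle_dist x p)\<^sup>2 \<partial>arclength) = 2 * pi * B + 2 * pi ^ 3 / 3"
    using ints by (simp add: integral_arclength_circle_dist_sq[OF p] measure_arclength)
  also have "(1 - \<alpha>) / (2 * pi) * (2 * pi * B + 2 * pi ^ 3 / 3) = (1 - \<alpha>) * (B + pi\<^sup>2 / 3)"
    by (simp add: field_simps power2_eq_square power3_eq_cube)
  finally have "(\<integral>x. f x * h x \<partial>arclength) \<le> (1 - \<alpha>) * (B + pi\<^sup>2 / 3)" .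
  moreover have "(\<integral>x. f x * h x \<partial>arclength) = B - 2 * F q + 2 * F p"
  proof -
    have "(\<integral>x. f x * h x \<partial>arclength)
        = (\<integral>x. B * f x - f x * (circle_dist x q)\<^sup>2 + f x * (circle_dist x p)\<^sup>2 \<partial>arclength)"
      unfolding h_def by (simp add: algebra_simps)
    also have "\<dots> = B - 2 * F q + 2 * F p"
      using ints unfolding F_def frechet_functional_density[OF f q] frechet_functional_density[OF f p]
      by (simp add: integral_density_eq_1[OF f])
    finally show ?thesis .
  qed
  moreover have "(1 - \<alpha>) * pi\<^sup>2 < 3 * \<alpha> * B" using bound by (simp add: B_def)
  moreover have "(1 - \<alpha>) * (B + pi\<^sup>2 / 3) = B - \<alpha> * B + (1 - \<alpha>) * pi\<^sup>2 / 3"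
    by (simp add: algebra_simps)
  ultimately show ?thesis unfolding q_def[symmetric] by linarith
qed

section \<open>The condition on \<open>\<alpha>\<close>\<close>

text \<open>
  The polynomial is positive at \<open>1\<close>, so a negative value at a point of \<open>{0<..1}\<close> beyond the
  unique root would produce a second root.
\<close>

lemma alpha_poly_nonneg:
  assumes \<delta>: "0 < \<delta>" "\<delta> < 1 / 2" and "alpha_bound \<delta> \<le> \<alpha>" "\<alpha> \<le> 1"
  shows "0 < \<alpha>" "0 \<le> poly (alpha_poly \<delta>) (sqrt \<alpha>)"
proof -
  let ?p = "alpha_poly \<delta>"
  define r where "r = (THE X. X \<in> {0<..1} \<and> poly ?p X = 0)"
  have r: "0 < r" "r \<le> 1" "poly ?p r = 0"
    using theI'[OF alpha_poly_root_ex1[OF \<delta>]] unfolding r_def by auto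
  have "r\<^sup>2 \<le> \<alpha>" using assms(3) unfolding alpha_bound_def r_def .
  then show "0 < \<alpha>" using r by (smt (verit) zero_less_power)
  have r\<alpha>: "r \<le> sqrt \<alpha>" using \<open>r\<^sup>2 \<le> \<alpha>\<close> by (rule real_le_rsqrt)
  show "0 \<le> poly ?p (sqrt \<alpha>)"
  proof (rule ccontr)
    assume neg: "\<not> 0 \<le> poly ?p (sqrt \<alpha>)"
    have p1: "0 < poly ?p 1" using \<delta> by (simp add: alpha_poly_def)
    have "sqrt \<alpha> < 1" using neg p1 \<open>\<alpha> \<le> 1\<close> by (cases "\<alpha> = 1") auto
    then obtain x where "sqrt \<alpha> < x" "x < 1" "poly ?p x = 0"
      using poly_IVT_pos[of "sqrt \<alpha>" 1 ?p] neg p1 by auto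
    moreover from this have "0 < x" "x \<noteq> r" using r r\<alpha> by linarith+
    ultimately have "x \<in> {0<..1} \<and> poly ?p x = 0" "r \<in> {0<..1} \<and> poly ?p r = 0" "x \<noteq> r"
      using r by simp_all
    then show False using alpha_poly_root_ex1[OF \<delta>] by blast
  qed
qed

text \<open>
  The polynomial is a positive multiple of the quadratic plus a remainder that is negative on
  \<open>{0<..1}\<close>.
\<close>

lemma alpha_poly_imp_quadratic:
  assumes \<delta>: "0 < \<delta>" "\<delta> < 1 / 2" and X: "0 < X" "X \<le> 1" and "0 \<le> poly (alpha_poly \<delta>) X"
  shows "0 < (2 - 3 * \<delta>) * X\<^sup>2 + X - 1"
proof (rule ccontr)
  assume "\<not> ?thesis"
  then have "2 * X * ((2 - 3 * \<delta>) * X\<^sup>2 + X - 1) \<le> 0" using X by (simp add: mult_le_0_iff)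
  moreover have "poly (alpha_poly \<delta>) X = 2 * X * ((2 - 3 * \<delta>) * X\<^sup>2 + X - 1)
      - (1 + \<delta>\<^sup>2) * X\<^sup>2 * (1 - X) - ((1 - X) + 2 * \<delta> * X)"
    unfolding alpha_poly_def by (simp add: algebra_simps power2_eq_square)
  moreover have "0 \<le> (1 + \<delta>\<^sup>2) * X\<^sup>2 * (1 - X)" "0 < 2 * \<delta> * X" using X \<delta> by auto
  ultimately show False using assms(5) X by linarith
qed

text \<open>
  With \<open>X = sqrt \<alpha>\<close> and \<open>u = \<phi> / pi \<le> \<delta> * X / (1 + X)\<close>, multiplying \<open>X * (2 - 3 * u) > 1\<close> by
  \<open>1 + X\<close> turns it into a consequence of the quadratic inequality above.
\<close>

lemma concentration_bound:
  assumes \<delta>: "0 < \<delta>" "\<delta> < 1 / 2" and \<alpha>: "alpha_bound \<delta> \<le> \<alpha>" "\<alpha> \<le> 1"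
    and \<phi>: "\<phi> \<le> \<delta> * phi_bound \<alpha>"
  shows "4 * \<phi> < pi" "(1 - \<alpha>) * pi\<^sup>2 < 3 * \<alpha> * ((pi - \<phi>) * (pi - 3 * \<phi>))"
proof -
  define X where "X = sqrt \<alpha>"
  define u where "u = \<phi> / pi"
  have \<phi>u: "\<phi> = u * pi" by (simp add: u_def)
  have X: "0 < X" "X \<le> 1" "\<alpha> = X\<^sup>2" using alpha_poly_nonneg(1)[OF \<delta> \<alpha>] \<alpha>(2) by (auto simp: X_def)
  have u: "u \<le> \<delta> * X / (1 + X)"
    using \<phi> unfolding u_def phi_bound_def X_def by (simp add: divide_le_eq algebra_simps)
  have uX: "u * (1 + X) \<le> \<delta> * X" using u X by (simp add: pos_le_divide_eq)
  have "\<delta> * X * 4 < 1 + X"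
  proof -
    have "\<delta> * X < 1 / 2 * X" using \<delta> X by (intro mult_strict_right_mono)
    then show ?thesis using X by linarith
  qed
  then have "\<delta> * X / (1 + X) < 1 / 4" using X by (simp add: divide_less_eq)
  with u have u4: "u < 1 / 4" by linarith
  then show "4 * \<phi> < pi" unfolding \<phi>u by simp
  have "0 < (2 - 3 * \<delta>) * X\<^sup>2 + X - 1"
    using alpha_poly_imp_quadratic[OF \<delta> X(1,2)] alpha_poly_nonneg(2)[OF \<delta> \<alpha>] by (simp add: X_def)
  moreover have "X * (3 * (u * (1 + X))) \<le> X * (3 * (\<delta> * X))" using uX X by simp
  ultimately have "1 * (1 + X) < X * (2 - 3 * u) * (1 + X)"
    by (simp add: algebra_simps power2_eq_square)
  then have "1 < X * (2 - 3 * u)" using X by (subst (asm) mult_less_cancel_right_pos) auto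
  then have "1 < (X * (2 - 3 * u))\<^sup>2" by (simp add: one_less_power)
  \<comment> \<open>\<open>3 * (1 - u) * (1 - 3 * u) + 1\<close> is the square of \<open>2 - 3 * u\<close>.\<close>
  then have "1 - \<alpha> < 3 * \<alpha> * ((1 - u) * (1 - 3 * u))"
    unfolding X(3) by (simp add: algebra_simps power2_eq_square)
  then have "(1 - \<alpha>) * pi\<^sup>2 < 3 * \<alpha> * ((1 - u) * (1 - 3 * u)) * pi\<^sup>2" by simp
  then show "(1 - \<alpha>) * pi\<^sup>2 < 3 * \<alpha> * ((pi - \<phi>) * (pi - 3 * \<phi>))"
    unfolding \<phi>u by (simp add: algebra_simps power2_eq_square)
qed

section \<open>Uniqueness of the Frechet mean\<close>

theorem theorem4p2:
  fixes \<delta> \<alpha> \<phi> :: real and f :: "real^2 \<Rightarrow> real" and \<mu> :: "(real^2) measure"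
  assumes "0 < \<delta>" and "\<delta> < 1 / 2"
    and "0 < \<phi>" and "\<phi> < pi"
    and "circle_prob_density f"
    and "\<mu> = density arclength (\<lambda>x. ennreal (f x))"
    and "property_P \<alpha> \<phi> f"
    and "alpha_bound \<delta> \<le> \<alpha>" and "\<alpha> \<le> 1"
    and "\<phi> \<le> \<delta> * phi_bound \<alpha>"
  shows "\<exists>!p. frechet_minimizer \<mu> p"
proof -
  note \<delta> = assms(1,2) and f = assms(5) and \<alpha> = assms(8,9)
  obtain p where p: "p \<in> circle" and P: "property_P_at p \<alpha> \<phi> f"
    using assms(7) by (auto simp: property_P_def)
  note conc = concentration_bound[OF \<delta> \<alpha> assms(10)]
  have \<alpha>0: "0 < \<alpha>" using alpha_poly_nonneg(1)[OF \<delta> \<alpha>] .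
  let ?F = "frechet_functional \<mu>"
  have near: "\<exists>t. \<bar>t\<bar> \<le> pi - \<phi> \<and> q = circle_param p t" if "frechet_minimizer \<mu> q" for q
  proof -
    have q: "q \<in> circle" "?F q \<le> ?F p"
      using that p unfolding frechet_minimizer_def by blast+
    obtain t where t: "t \<in> {-pi..<pi}" "q = circle_param p t"
      using circle_param_surj[OF p q(1)] .
    have "\<not> pi - \<phi> \<le> \<bar>t\<bar>"
    proof
      assume "pi - \<phi> \<le> \<bar>t\<bar>"
      then have "?F p < ?F q"
        unfolding assms(6) t(2) using conc t assms(3,9) \<alpha>0
        by (intro frechet_functional_near_antipode[OF f p P]) auto
      then show False using q(2) by simp
    qed
    then show ?thesis using t(2) by (intro exI[of _ t]) simp
  qed
  have "\<exists>q\<in>circle. \<forall>y\<in>circle. ?F q \<le> ?F y"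
    unfolding assms(6) using p
    by (intro continuous_attains_inf continuous_frechet_functional[OF f]) auto
  then obtain q where "frechet_minimizer \<mu> q" by (auto simp: frechet_minimizer_def)
  moreover have "q1 = q2" if min: "frechet_minimizer \<mu> q1" "frechet_minimizer \<mu> q2" for q1 q2
  proof (rule ccontr)
    assume "q1 \<noteq> q2"
    obtain s t where st: "\<bar>s\<bar> \<le> pi - \<phi>" "q1 = circle_param p s" "\<bar>t\<bar> \<le> pi - \<phi>" "q2 = circle_param p t"
      using near min by metis
    let ?m = "circle_param p ((s + t) / 2)"
    have "2 * ?F ?m < ?F q1 + ?F q2"
      unfolding assms(6) st using st \<open>q1 \<noteq> q2\<close> \<alpha>0 assms(3,9)
      by (intro frechet_functional_midpoint[OF f p P]) auto
    moreover have "?F q1 \<le> ?F ?m" "?F q2 \<le> ?F ?m"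
      using min circle_param_in_circle[OF p] unfolding frechet_minimizer_def by blast+
    ultimately show False by linarith
  qed
  ultimately show ?thesis by blast
qed

end
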